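(* Suppose a simple graph $G$ on $n$ vertices admits an $\varepsilon$-factorization via $(H,K,E)$. For each $w\in V(G)$ define the witness set $S_w:=N_H(w)\times N_K(w)\subseteq V(G)\times V(G)$, and for an ordered pair $(u,v)\in V(G)\times V(G)$ define $m(u,v):=|\{w\in V(G):(u,v)\in S_w\}|$. Then the following hold: \begin{enumerate} \item For every non-error entry $(u,v)\in\mathrm{Good}$, $m(u,v)=A(G)_{uv}$. \item If $U:=\bigcup_{w\in V(G)}S_w$, then $|U\,\triangle\,\mathcal A(G)|\le \varepsilon n^2$. \item $\{(u,v)\in V(G)\times V(G): m(u,v)\ge 2\}\subseteq \operatorname{supp}(E)$. \item If $\varepsilon=0$, then $\mathcal A(G)=\bigsqcup_{w\in V(G)}S_w$ (a disjoint union). \end{enumerate}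
   Context: All graphs are finite, simple and undirected; $N_H(u)$ is the set of neighbours of $u$ in $H$ and $A(H)$ is the adjacency matrix of $H$. Let $0\le \varepsilon\le 1$. Fix an ordering $v_1,\dots,v_n$ of $V(G)$ and identify vertices with their indices. $G$ admits an $\varepsilon$-factorization via $(H,K,E)$ means: $H$ and $K$ are simple graphs on $V(G)$, $E\in\{0,1\}^{n\times n}$ has at most $\varepsilon n^2$ nonzero entries, and $(A(H)A(K))_{ij}=A(G)_{ij}$ for every $(i,j)$ with $E_{ij}=0$. Further, $\mathrm{Good}:=\{(i,j):E_{ij}=0\}$ is the set of non-error entries, $\operatorname{supp}(E):=\{(i,j):E_{ij}=1\}$, and $\mathcal A(G):=\{(i,j):A(G)_{ij}=1\}$ is the set of ordered adjacency entries of $G$ (each undirected edge contributes two ordered pairs). $\triangle$ denotes symmetric difference. *)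

theory Defs
  imports
    "Jordan_Normal_Form.Matrix"
    "Graph_Theory.Pair_Digraph"
    "HOL-Library.Disjoint_Sets"
begin

text \<open>
  A finite simple undirected graph is a \<^locale>\<open>pair_graph\<close>: a finite vertex set with a symmetric,
  irreflexive set of arcs, so that an undirected edge between u and w is the pair of arcs (u, w) and
  (w, u).

  The vertices of a graph on n vertices are ordered by a bijection v from the indices 0, ..., n - 1
  to the vertex set. Matrix entries are addressed by indices; \<^term>\<open>map_prod v v\<close> turns a set of
  entries into the corresponding set of ordered pairs of vertices.
\<close>

definition neighbours :: "'a pair_pre_digraph \<Rightarrow> 'a \<Rightarrow> 'a set" where
  "neighbours H u = {w. (u, w) \<in> parcs H}"

definition adjacency_matrix :: "nat \<Rightarrow> (nat \<Rightarrow> 'a) \<Rightarrow> 'a pair_pre_digraph \<Rightarrow> int mat" where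
  "adjacency_matrix n v H = mat n n (\<lambda>(i, j). if (v i, v j) \<in> parcs H then 1 else 0)"

definition entries_eq :: "int mat \<Rightarrow> int \<Rightarrow> (nat \<times> nat) set" where
  "entries_eq M c = {(i, j). i < dim_row M \<and> j < dim_col M \<and> M $$ (i, j) = c}"

definition Good :: "int mat \<Rightarrow> (nat \<times> nat) set" where
  "Good E = entries_eq E 0"

definition supp :: "int mat \<Rightarrow> (nat \<times> nat) set" where
  "supp E = entries_eq E 1"

definition adjacency_entries ::
    "nat \<Rightarrow> (nat \<Rightarrow> 'a) \<Rightarrow> 'a pair_pre_digraph \<Rightarrow> (nat \<times> nat) set" where
  "adjacency_entries n v G = entries_eq (adjacency_matrix n v G) 1"

definition eps_factorization ::
    "real \<Rightarrow> nat \<Rightarrow> (nat \<Rightarrow> 'a) \<Rightarrow> 'a pair_pre_digraph \<Rightarrow>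
     'a pair_pre_digraph \<Rightarrow> 'a pair_pre_digraph \<Rightarrow> int mat \<Rightarrow> bool" where
  "eps_factorization \<epsilon> n v G H K E \<longleftrightarrow>
     pair_graph H \<and> pverts H = pverts G \<and>
     pair_graph K \<and> pverts K = pverts G \<and>
     E \<in> carrier_mat n n \<and>
     (\<forall>i<n. \<forall>j<n. E $$ (i, j) \<in> {0, 1}) \<and>
     real (card {(i, j). i < n \<and> j < n \<and> E $$ (i, j) \<noteq> 0}) \<le> \<epsilon> * real n ^ 2 \<and>
     (\<forall>i<n. \<forall>j<n. E $$ (i, j) = 0 \<longrightarrow>
        (adjacency_matrix n v H * adjacency_matrix n v K) $$ (i, j) = adjacency_matrix n v G $$ (i, j))"

definition witness_set :: "'a pair_pre_digraph \<Rightarrow> 'a pair_pre_digraph \<Rightarrow> 'a \<Rightarrow> ('a \<times> 'a) set" where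
  "witness_set H K w = neighbours H w \<times> neighbours K w"

definition witness_count ::
    "'a pair_pre_digraph \<Rightarrow> 'a pair_pre_digraph \<Rightarrow> 'a pair_pre_digraph \<Rightarrow> 'a \<Rightarrow> 'a \<Rightarrow> nat" where
  "witness_count G H K x y = card {w \<in> pverts G. (x, y) \<in> witness_set H K w}"

end

theory Submission
  imports Defs
begin

text \<open>
  A witness \<open>w\<close> of the pair \<open>(x, y)\<close> is a neighbour of \<open>x\<close> in \<open>H\<close> and of \<open>y\<close> in \<open>K\<close>, that is, the
  middle vertex of a walk from \<open>x\<close> to \<open>y\<close> whose first step lies in \<open>H\<close> and whose second step lies
  in \<open>K\<close>. The entries of the product of the two adjacency matrices count exactly these walks
  (\<open>adjacency_matrix_mult_entry\<close>), so at every non-error entry the number of witnesses is the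
  corresponding entry of \<open>A(G)\<close>.

  That entry is 0 or 1. At a non-error entry, therefore, at most one witness exists, and one exists
  if and only if the pair is an arc of \<open>G\<close>. Hence a pair with two witnesses, as well as a
  pair on which the union of the witness sets disagrees with the adjacency relation, sits at an
  error entry, and there are at most \<open>\<epsilon> n\<^sup>2\<close> of those. For \<open>\<epsilon> = 0\<close> there are none: the union
  is the whole adjacency relation, and two overlapping witness sets would give a pair with two
  witnesses.
\<close>

lemma mem_witness_set_iff:
  "(x, y) \<in> witness_set H K w \<longleftrightarrow> (w, x) \<in> parcs H \<and> (w, y) \<in> parcs K"
  by (simp add: witness_set_def neighbours_def)

text \<open>
  A term of the matrix product is 1 if and only if its summation index is the middle vertex of a
  walk. The walk enters this vertex by the arc \<open>(v i, w)\<close>, while a witness has the arc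
  \<open>(w, v i)\<close> leaving it; the symmetry of \<open>H\<close> identifies the two.
\<close>

lemma adjacency_matrix_mult_entry:
  assumes H: "pair_graph H" and v: "bij_betw v {..<n} (pverts G)" and "i < n" "j < n"
  shows "(adjacency_matrix n v H * adjacency_matrix n v K) $$ (i, j) =
    int (witness_count G H K (v i) (v j))"
proof -
  interpret H: pair_graph H by (rule H)
  have H_sym: "(x, y) \<in> parcs H \<longleftrightarrow> (y, x) \<in> parcs H" for x y
    using H.arcs_symmetric by blast
  let ?W = "{k. k < n \<and> (v i, v k) \<in> parcs H \<and> (v k, v j) \<in> parcs K}"
  have "(adjacency_matrix n v H * adjacency_matrix n v K) $$ (i, j) =
      (\<Sum>k<n. (if (v i, v k) \<in> parcs H then 1 else 0) * (if (v k, v j) \<in> parcs K then 1 else 0))"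
    using assms(3,4) by (simp add: adjacency_matrix_def scalar_prod_def lessThan_atLeast0)
  also have "\<dots> = (\<Sum>k<n. if (v i, v k) \<in> parcs H \<and> (v k, v j) \<in> parcs K then 1 else 0)"
    by (rule sum.cong) auto
  also have "\<dots> = int (card ?W)"
    by (simp add: sum.If_cases Int_def lessThan_def)
  also have "card ?W = card (v ` ?W)"
    by (rule card_image[symmetric]) (use v in \<open>auto simp: bij_betw_def inj_on_def\<close>)
  also have "v ` ?W = {w \<in> pverts G. (v i, v j) \<in> witness_set H K w}"
    using v H_sym by (auto simp: bij_betw_def mem_witness_set_iff)
  finally show ?thesis by (simp add: witness_count_def)
qed

lemma map_prod_adjacency_entries:
  assumes "pair_graph G" and v: "bij_betw v {..<n} (pverts G)"
  shows "map_prod v v ` adjacency_entries n v G = parcs G"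
proof -
  interpret G: pair_graph G by fact
  show ?thesis
  proof (intro equalityI subsetI)
    fix p assume "p \<in> parcs G"
    then obtain x y where p: "p = (x, y)" "(x, y) \<in> parcs G"
      by (cases p) auto
    then have "x \<in> v ` {..<n}" "y \<in> v ` {..<n}"
      using v G.in_arcsD1 G.in_arcsD2 by (auto simp: bij_betw_def)
    then obtain i j where "i < n" "x = v i" "j < n" "y = v j"
      by auto
    with p have "(i, j) \<in> adjacency_entries n v G"
      by (simp add: adjacency_entries_def entries_eq_def adjacency_matrix_def)
    with p \<open>x = v i\<close> \<open>y = v j\<close> show "p \<in> map_prod v v ` adjacency_entries n v G"
      by force
  qed (auto simp: adjacency_entries_def entries_eq_def adjacency_matrix_def split: if_splits)
qed

lemma eps_factorizationD:
  assumes "eps_factorization \<epsilon> n v G H K E"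
  shows "pair_graph H" "pverts H = pverts G" "pair_graph K" "pverts K = pverts G"
    and "dim_row E = n" "dim_col E = n"
    and "real (card {(i, j). i < n \<and> j < n \<and> E $$ (i, j) \<noteq> 0}) \<le> \<epsilon> * real n ^ 2"
    and "\<lbrakk>i < n; j < n\<rbrakk> \<Longrightarrow> E $$ (i, j) \<in> {0, 1}"
    and "\<lbrakk>i < n; j < n; E $$ (i, j) = 0\<rbrakk> \<Longrightarrow>
      (adjacency_matrix n v H * adjacency_matrix n v K) $$ (i, j) = adjacency_matrix n v G $$ (i, j)"
  using assms unfolding eps_factorization_def by (blast | (elim conjE, erule carrier_matD))+

lemma witness_set_subset_pverts:
  assumes "eps_factorization \<epsilon> n v G H K E"
  shows "witness_set H K w \<subseteq> pverts G \<times> pverts G"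
proof -
  note D = eps_factorizationD[OF assms]
  interpret H: pair_graph H by (rule D)
  interpret K: pair_graph K by (rule D)
  show ?thesis
    using D(2,4) H.in_arcsD2 K.in_arcsD2 by (auto simp: mem_witness_set_iff)
qed

lemma mem_Good_iff:
  assumes "eps_factorization \<epsilon> n v G H K E"
  shows "(i, j) \<in> Good E \<longleftrightarrow> i < n \<and> j < n \<and> E $$ (i, j) = 0"
  by (simp add: Good_def entries_eq_def eps_factorizationD(5,6)[OF assms])

lemma mem_supp_iff:
  assumes "eps_factorization \<epsilon> n v G H K E"
  shows "(i, j) \<in> supp E \<longleftrightarrow> i < n \<and> j < n \<and> E $$ (i, j) \<noteq> 0"
  using eps_factorizationD(8)[OF assms, of i j]
  by (auto simp: supp_def entries_eq_def eps_factorizationD(5,6)[OF assms])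

lemma finite_supp: "finite (supp E)"
  by (rule finite_subset[of _ "{..<dim_row E} \<times> {..<dim_col E}"])
    (auto simp: supp_def entries_eq_def)

lemma witness_count_Good:
  assumes v: "bij_betw v {..<n} (pverts G)" and fact: "eps_factorization \<epsilon> n v G H K E"
    and good: "(i, j) \<in> Good E"
  shows "int (witness_count G H K (v i) (v j)) = adjacency_matrix n v G $$ (i, j)"
  using adjacency_matrix_mult_entry[OF eps_factorizationD(1)[OF fact] v, of i j K]
    eps_factorizationD(9)[OF fact, of i j] good
  by (simp add: mem_Good_iff[OF fact])

lemma witness_count_Good_parcs:
  assumes "bij_betw v {..<n} (pverts G)" "eps_factorization \<epsilon> n v G H K E" "(i, j) \<in> Good E"
  shows "witness_count G H K (v i) (v j) = (if (v i, v j) \<in> parcs G then 1 else 0)"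
proof -
  have "i < n" "j < n"
    using assms(3) by (simp_all add: mem_Good_iff[OF assms(2)])
  with witness_count_Good[OF assms] show ?thesis
    by (simp add: adjacency_matrix_def split: if_splits)
qed

text \<open>
  The contrapositive of the count at non-error entries, read on pairs of vertices. Each of the
  bounds on exceptional pairs is an instance of it.
\<close>

lemma mem_map_prod_suppI:
  assumes v: "bij_betw v {..<n} (pverts G)" and fact: "eps_factorization \<epsilon> n v G H K E"
    and xy: "x \<in> pverts G" "y \<in> pverts G"
    and bad: "witness_count G H K x y \<noteq> (if (x, y) \<in> parcs G then 1 else 0)"
  shows "(x, y) \<in> map_prod v v ` supp E"
proof -
  have "x \<in> v ` {..<n}" "y \<in> v ` {..<n}"
    using v xy by (auto simp: bij_betw_def)
  then obtain i j where ij: "i < n" "j < n" "x = v i" "y = v j"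
    by auto
  then have "(i, j) \<notin> Good E"
    using witness_count_Good_parcs[OF v fact] bad by blast
  then have "(i, j) \<in> supp E"
    using ij by (simp add: mem_Good_iff[OF fact] mem_supp_iff[OF fact])
  with ij show ?thesis by force
qed

lemma witness_count_pos_iff:
  assumes "finite (pverts G)"
  shows "witness_count G H K x y > 0 \<longleftrightarrow> (x, y) \<in> (\<Union>w\<in>pverts G. witness_set H K w)"
  using assms by (auto simp: witness_count_def card_gt_0_iff)

text \<open>
  The union and the adjacency relation record whether the number of witnesses, respectively the
  entry of \<open>A(G)\<close>, is positive; where they disagree, these two numbers differ.
\<close>

lemma sym_diff_witness_sets_subset_supp:
  assumes G: "pair_graph G" and v: "bij_betw v {..<n} (pverts G)"
    and fact: "eps_factorization \<epsilon> n v G H K E"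
  shows "sym_diff (\<Union>w\<in>pverts G. witness_set H K w) (parcs G) \<subseteq> map_prod v v ` supp E"
proof
  interpret G: pair_graph G by (rule G)
  fix p assume p: "p \<in> sym_diff (\<Union>w\<in>pverts G. witness_set H K w) (parcs G)"
  obtain x y where xy: "p = (x, y)" by (cases p)
  have "(x, y) \<in> pverts G \<times> pverts G"
    using p witness_set_subset_pverts[OF fact] G.in_arcsD1[of x y] G.in_arcsD2[of x y] unfolding xy by blast
  moreover have "witness_count G H K x y \<noteq> (if (x, y) \<in> parcs G then 1 else 0)"
    using p witness_count_pos_iff[of G H K x y] G.pair_finite_verts unfolding xy by auto
  ultimately show "p \<in> map_prod v v ` supp E"
    using mem_map_prod_suppI[OF v fact, of x y] unfolding xy by blast
qed

lemma witness_count_ge_2_subset_supp: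
  assumes "bij_betw v {..<n} (pverts G)" "eps_factorization \<epsilon> n v G H K E"
  shows "{(x, y) \<in> pverts G \<times> pverts G. witness_count G H K x y \<ge> 2} \<subseteq> map_prod v v ` supp E"
proof safe
  fix x y assume xy: "x \<in> pverts G" "y \<in> pverts G" and "witness_count G H K x y \<ge> 2"
  then have "witness_count G H K x y \<noteq> (if (x, y) \<in> parcs G then 1 else 0)"
    by simp
  with xy show "(x, y) \<in> map_prod v v ` supp E"
    by (rule mem_map_prod_suppI[OF assms])
qed

lemma witness_count_ge_2I:
  assumes "finite (pverts G)" "w \<in> pverts G" "w' \<in> pverts G" "w \<noteq> w'"
    and "(x, y) \<in> witness_set H K w" "(x, y) \<in> witness_set H K w'"
  shows "witness_count G H K x y \<ge> 2"
proof -
  have "card {w, w'} \<le> witness_count G H K x y"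
    unfolding witness_count_def using assms by (intro card_mono) auto
  with assms(4) show ?thesis by simp
qed

theorem theorem1:
  fixes G H K :: "'a pair_pre_digraph" and n :: nat and v :: "nat \<Rightarrow> 'a"
    and E :: "int mat" and \<epsilon> :: real
  assumes "0 \<le> \<epsilon>" and "\<epsilon> \<le> 1"
    and "pair_graph G"
    and "bij_betw v {..<n} (pverts G)"
    and "eps_factorization \<epsilon> n v G H K E"
  shows
    "(\<forall>(i, j) \<in> Good E. int (witness_count G H K (v i) (v j)) = adjacency_matrix n v G $$ (i, j)) \<and>
     real (card (sym_diff (\<Union>w\<in>pverts G. witness_set H K w) (map_prod v v ` adjacency_entries n v G)))
       \<le> \<epsilon> * real n ^ 2 \<and>
     {(x, y) \<in> pverts G \<times> pverts G. witness_count G H K x y \<ge> 2} \<subseteq> map_prod v v ` supp E \<and>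
     (\<epsilon> = 0 \<longrightarrow>
        map_prod v v ` adjacency_entries n v G = (\<Union>w\<in>pverts G. witness_set H K w) \<and>
        disjoint_family_on (witness_set H K) (pverts G))"
proof (intro conjI impI)
  note G = assms(3) and v = assms(4) and fact = assms(5)
  interpret G: pair_graph G by (rule G)
  note adj = map_prod_adjacency_entries[OF G v]
  note diff = sym_diff_witness_sets_subset_supp[OF G v fact]
  note twice = witness_count_ge_2_subset_supp[OF v fact]
  have card_supp: "real (card (supp E)) \<le> \<epsilon> * real n ^ 2"
  proof -
    have "supp E = {(i, j). i < n \<and> j < n \<and> E $$ (i, j) \<noteq> 0}"
      using mem_supp_iff[OF fact] by auto
    then show ?thesis
      using eps_factorizationD(7)[OF fact] by simp
  qed

  show "\<forall>(i, j) \<in> Good E.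
      int (witness_count G H K (v i) (v j)) = adjacency_matrix n v G $$ (i, j)"
    using witness_count_Good[OF v fact] by blast
  show "{(x, y) \<in> pverts G \<times> pverts G. witness_count G H K x y \<ge> 2} \<subseteq> map_prod v v ` supp E"
    by (rule twice)
  have "card (sym_diff (\<Union>w\<in>pverts G. witness_set H K w) (parcs G)) \<le> card (supp E)"
    using surj_card_le[OF finite_supp diff] .
  with card_supp
  show "real (card (sym_diff (\<Union>w\<in>pverts G. witness_set H K w)
      (map_prod v v ` adjacency_entries n v G))) \<le> \<epsilon> * real n ^ 2"
    unfolding adj by linarith

  assume "\<epsilon> = 0"
  with card_supp have no_error: "supp E = {}"
    using finite_supp[of E] by simp
  from diff show "map_prod v v ` adjacency_entries n v G = (\<Union>w\<in>pverts G. witness_set H K w)"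
    unfolding adj no_error by blast
  show "disjoint_family_on (witness_set H K) (pverts G)"
    unfolding disjoint_family_on_def
  proof (intro ballI impI equals0I)
    fix w w' p
    assume w: "w \<in> pverts G" "w' \<in> pverts G" "w \<noteq> w'"
      and p: "p \<in> witness_set H K w \<inter> witness_set H K w'"
    obtain x y where xy: "p = (x, y)" by (cases p)
    have "witness_count G H K x y \<ge> 2"
      using witness_count_ge_2I[OF G.pair_finite_verts w] p xy by blast
    moreover have "(x, y) \<in> pverts G \<times> pverts G"
      using p witness_set_subset_pverts[OF fact] xy by blast
    ultimately show False
      using twice unfolding no_error by auto
  qed
qed

end
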